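(* Let $G$ be a nontrivial finite group. (1) If all maximal subgroups of $G$ have odd order, then $\mathrm{DNG}(G)=*1$. (2) If all maximal subgroups of $G$ have even order, then $\mathrm{DNG}(G)=*0$. (3) Assume $G$ has both a maximal subgroup of even order and a maximal subgroup of odd order. (a) If the set of maximal subgroups of $G$ of even order covers $G$, then $\mathrm{DNG}(G)=*0$. (b) If the set of maximal subgroups of $G$ of even order does not cover $G$, then $\mathrm{DNG}(G)=*3$.
   Context: For a nontrivial finite group $G$, the avoidance game $\mathrm{DNG}(G)$ is the impartial game whose positions are the subsets $P\subseteq G$ with $\langle P\rangle\ne G$; the starting position is $\emptyset$; the options of $P$ are the positions of the form $P\cup\{g\}$ with $g\in G\setminus P$ (and $\langle P\cup\{g\}\rangle\neq G$). Two players alternate moves, and a player who cannot move loses (normal play). The nim-number of a position $P$ is defined recursively by $\mathrm{nim}(P)=\mathrm{mex}\{\mathrm{nim}(Q)\mid Q \text{ an option of } P\}$, where $\mathrm{mex}(A)$ is the least non-negative integer not in $A$. The notation $\mathrm{DNG}(G)=*n$ means that the starting position $\emptyset$ has nim-number $n$. A set of subgroups covers $G$ if its union is $G$. *)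

theory Defs
  imports "HOL-Algebra.Generated_Groups"
begin

definition mex :: "nat set \<Rightarrow> nat" where
  "mex A = (LEAST n. n \<notin> A)"

text \<open>An impartial game is given by the function \<open>opts\<close> assigning to each position its set of
  options. The recursion is meaningful when no infinite play exists, see \<open>nim_number_rec\<close>.\<close>

definition nim_number :: "('p \<Rightarrow> 'p set) \<Rightarrow> 'p \<Rightarrow> nat" where
  "nim_number opts = wfrec {(q, p). q \<in> opts p} (\<lambda>nim p. mex (nim ` opts p))"

lemma nim_number_rec:
  assumes "wf {(q, p). q \<in> opts p}"
  shows "nim_number opts p = mex {nim_number opts q | q. q \<in> opts p}"
proof -
  have "nim_number opts p
      = mex (cut (nim_number opts) {(q, p). q \<in> opts p} p ` opts p)"
    unfolding nim_number_def by (subst wfrec[OF assms]) (rule refl)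
  also have "cut (nim_number opts) {(q, p). q \<in> opts p} p ` opts p
      = {nim_number opts q | q. q \<in> opts p}"
    by (auto simp: cut_apply image_iff)
  finally show ?thesis .
qed

definition dng_positions :: "('a, 'b) monoid_scheme \<Rightarrow> 'a set set" where
  "dng_positions G = {P. P \<subseteq> carrier G \<and> generate G P \<noteq> carrier G}"

definition dng_opts :: "('a, 'b) monoid_scheme \<Rightarrow> 'a set \<Rightarrow> 'a set set" where
  "dng_opts G P = {P \<union> {g} | g. g \<in> carrier G - P \<and> P \<union> {g} \<in> dng_positions G}"

lemma wf_dng_opts:
  assumes "finite (carrier G)"
  shows "wf {(Q, P). Q \<in> dng_opts G P}"
proof (rule wf_subset)
  show "wf (measure (\<lambda>P. card (carrier G - P)))" by simp
  show "{(Q, P). Q \<in> dng_opts G P} \<subseteq> measure (\<lambda>P. card (carrier G - P))"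
    using assms unfolding dng_opts_def by (auto simp: card_gt_0_iff intro!: diff_less) blast
qed

text \<open>\<open>DNG(G) = *n\<close> is rendered as \<open>DNG G = n\<close>.\<close>

definition DNG :: "('a, 'b) monoid_scheme \<Rightarrow> nat" where
  "DNG G = nim_number (dng_opts G) {}"

definition maximal_subgroup :: "'a set \<Rightarrow> ('a, 'b) monoid_scheme \<Rightarrow> bool" where
  "maximal_subgroup M G \<longleftrightarrow>
     subgroup M G \<and> M \<noteq> carrier G \<and>
     (\<forall>H. subgroup H G \<longrightarrow> M \<subseteq> H \<longrightarrow> H = M \<or> H = carrier G)"

definition covers :: "'a set set \<Rightarrow> ('a, 'b) monoid_scheme \<Rightarrow> bool" where
  "covers \<M> G \<longleftrightarrow> \<Union>\<M> = carrier G"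

end

theory Submission
  imports Defs "HOL-Algebra.Sylow" "HOL-Algebra.Multiplicative_Group"
begin

text \<open>
  A set \<open>P\<close> is a position exactly when some maximal subgroup contains it, and play from \<open>P\<close>
  can only stop at a maximal subgroup \<open>M \<supseteq> P\<close>; every move changes the parity of \<open>card P\<close>. What
  matters about \<open>P\<close>, besides this parity, is therefore which parities occur among the maximal
  subgroups above \<open>P\<close> and how moves can change that. Two bits suffice: whether all
  maximal subgroups above \<open>P\<close> have odd order (\<open>only_odd_above\<close>), and if not, whether a single move can
  bring this about (\<open>odd_extendable\<close>). The nim-numbers are

    \<^item> \<open>1\<close> for even and \<open>0\<close> for odd \<open>card P\<close>, if only odd maximal subgroups lie above \<open>P\<close>;
    \<^item> \<open>3\<close> for even and \<open>2\<close> for odd \<open>card P\<close>, if some even maximal subgroup lies above \<open>P\<close> but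
      one move can exclude all of them;
    \<^item> \<open>0\<close> for even and \<open>1\<close> for odd \<open>card P\<close> otherwise.

  This is proved by induction along the game (\<open>nim_number_eq_dng_value\<close>). The moves that produce
  the required options are of three kinds. A move into the first class exists by definition of
  the second class. A move into the third class is supplied by an involution \<open>t\<close> of an even
  maximal subgroup \<open>M \<supseteq> P\<close>: every maximal subgroup containing \<open>t\<close> is even. Finally, a player
  facing an even \<open>P\<close> in the second class can play inside the intersection of the maximal
  subgroups above \<open>P\<close>, which changes none of them; the intersection is a subgroup of odd order,
  so it is larger than \<open>P\<close>.

  At the empty position the first bit asks whether all maximal subgroups are odd, and the second
  whether some \<open>g\<close> that does not generate \<open>G\<close> lies in no even maximal subgroup. The only
  discrepancy with covering \<open>G\<close> arises when the uncovered element generates \<open>G\<close>; then its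
  square does not, and is uncovered too (\<open>odd_above_generator_square\<close>).
\<close>

section \<open>Minimal excluded values\<close>

lemma mex_eqI:
  assumes "n \<notin> A" "\<And>k. k < n \<Longrightarrow> k \<in> A"
  shows "mex A = n"
  unfolding mex_def by (rule Least_equality) (use assms in \<open>auto intro: leI\<close>)

section \<open>Involutions and subgroups of even order\<close>

context group
begin

lemma even_order_involution:
  assumes fin: "finite (carrier G)" and M: "subgroup M G" and ev: "even (card M)"
  obtains t where "t \<in> M" "t \<noteq> \<one>" "t \<otimes> t = \<one>"
proof -
  let ?M = "G\<lparr>carrier := M\<rparr>"
  obtain m where m: "card M = 2 * m" using ev by auto
  have ord: "order ?M = 2 ^ 1 * m" unfolding order_def by (simp add: m)
  have "finite M" using fin M finite_subset subgroup.subset by blast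
  then have finM: "finite (carrier ?M)" by simp
  obtain H where H: "subgroup H ?M" and "card H = 2 ^ 1"
    using sylow_thm[OF two_is_prime_nat subgroup_imp_group[OF M] ord finM] by blast
  then have card: "card H = 2" by simp
  have one: "\<one> \<in> H" using subgroup.one_closed[OF H] by simp
  from card obtain x y where "H = {x, y}" "x \<noteq> y"
    by (auto simp: card_2_iff)
  then obtain t where t: "H = {\<one>, t}" "t \<noteq> \<one>" using one by auto
  have sub: "H \<subseteq> M" using subgroup.subset[OF H] by simp
  then have tM: "t \<in> M" and tG: "t \<in> carrier G" using t subgroup.subset[OF M] by auto
  have "t \<otimes> t \<in> H" using subgroup.m_closed[OF H, of t t] t by simp
  moreover have "t \<otimes> t \<noteq> t" using tG t(2) by simp
  ultimately show ?thesis using that tM t by auto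
qed

lemma pow_subgroup_card_eq_one:
  assumes fin: "finite (carrier G)" and M: "subgroup M G" and "t \<in> M"
  shows "t [^] card M = \<one>"
proof -
  have "finite M" using fin M finite_subset subgroup.subset by blast
  then show ?thesis
    using group.pow_order_eq_1[OF subgroup_imp_group[OF M], of t] assms(3)
    unfolding order_def by (simp flip: nat_pow_consistent)
qed

lemma subgroup_with_involution_even:
  assumes "finite (carrier G)" "subgroup M G" "t \<in> M" "t \<noteq> \<one>" "t \<otimes> t = \<one>"
  shows "even (card M)"
proof (rule ccontr)
  assume "odd (card M)"
  then obtain k where k: "card M = 2 * k + 1" by (elim oddE)
  have t: "t \<in> carrier G" using assms subgroup.subset by blast
  have sq: "t [^] (2::nat) = \<one>" using assms t by (simp add: numeral_2_eq_2)
  have "t [^] (2 * k) = \<one>" using sq t nat_pow_pow[of t 2 k] by simp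
  then show False using pow_subgroup_card_eq_one[OF assms(1-3)] k t assms(4) by simp
qed

section \<open>Positions and maximal subgroups\<close>

lemma maximal_subgroupD:
  assumes "maximal_subgroup M G"
  shows "subgroup M G" "M \<subseteq> carrier G" "M \<noteq> carrier G"
  using assms subgroup.subset unfolding maximal_subgroup_def by auto

lemma maximal_subgroup_subset_eq:
  assumes "maximal_subgroup M G" "maximal_subgroup N G" "M \<subseteq> N"
  shows "M = N"
  using assms unfolding maximal_subgroup_def by blast

lemma dng_positions_iff:
  assumes fin: "finite (carrier G)"
  shows "P \<in> dng_positions G \<longleftrightarrow> (\<exists>M. maximal_subgroup M G \<and> P \<subseteq> M)"
proof
  assume P: "P \<in> dng_positions G"
  then have sub: "P \<subseteq> carrier G" and ne: "generate G P \<noteq> carrier G"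
    by (auto simp: dng_positions_def)
  let ?S = "{H. subgroup H G \<and> H \<noteq> carrier G}"
  have "finite ?S"
    by (rule finite_subset[of _ "Pow (carrier G)"]) (auto dest: subgroup.subset simp: fin)
  moreover have "generate G P \<in> ?S" using generate_is_subgroup[OF sub] ne by auto
  ultimately have "\<exists>M\<in>?S. generate G P \<subseteq> M \<and> (\<forall>H\<in>?S. M \<subseteq> H \<longrightarrow> M = H)"
    by (rule finite_has_maximal2)
  then obtain M where "M \<in> ?S" "generate G P \<subseteq> M" "\<forall>H\<in>?S. M \<subseteq> H \<longrightarrow> M = H"
    by (elim bexE conjE)
  moreover have "P \<subseteq> generate G P" by (auto intro: generate.incl)
  ultimately show "\<exists>M. maximal_subgroup M G \<and> P \<subseteq> M"
    unfolding maximal_subgroup_def by blast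
next
  assume "\<exists>M. maximal_subgroup M G \<and> P \<subseteq> M"
  then obtain M where M: "maximal_subgroup M G" "P \<subseteq> M" by blast
  note Ms = maximal_subgroupD[OF M(1)]
  have "generate G P \<subseteq> M" using generate_subgroup_incl[OF M(2) Ms(1)] .
  then show "P \<in> dng_positions G" using M(2) Ms by (auto simp: dng_positions_def)
qed

lemma empty_dng_position:
  assumes "carrier G \<noteq> {\<one>}"
  shows "{} \<in> dng_positions G"
  using assms generate_empty by (auto simp: dng_positions_def)

end

section \<open>The predicted nim-numbers\<close>

definition only_odd_above :: "('a, 'b) monoid_scheme \<Rightarrow> 'a set \<Rightarrow> bool" where
  "only_odd_above G P \<longleftrightarrow> (\<forall>M. maximal_subgroup M G \<longrightarrow> P \<subseteq> M \<longrightarrow> odd (card M))"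

definition odd_extendable :: "('a, 'b) monoid_scheme \<Rightarrow> 'a set \<Rightarrow> bool" where
  "odd_extendable G P \<longleftrightarrow>
     (\<exists>g\<in>carrier G. insert g P \<in> dng_positions G \<and> only_odd_above G (insert g P))"

definition dng_value :: "('a, 'b) monoid_scheme \<Rightarrow> 'a set \<Rightarrow> nat" where
  "dng_value G P =
     (if only_odd_above G P then (if even (card P) then 1 else 0)
      else if odd_extendable G P then (if even (card P) then 3 else 2)
      else (if even (card P) then 0 else 1))"

lemma dng_value_range:
  shows "even (card P) \<Longrightarrow> dng_value G P \<in> {0, 1, 3}"
    and "odd (card P) \<Longrightarrow> dng_value G P \<in> {0, 1, 2}"
  by (auto simp: dng_value_def)

lemma only_odd_above_mono:
  "only_odd_above G P \<Longrightarrow> P \<subseteq> Q \<Longrightarrow> only_odd_above G Q"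
  unfolding only_odd_above_def by blast

lemma dng_opts_iff:
  "Q \<in> dng_opts G P \<longleftrightarrow>
     (\<exists>g. Q = insert g P \<and> g \<in> carrier G \<and> g \<notin> P \<and> insert g P \<in> dng_positions G)"
  by (auto simp: dng_opts_def)

lemma dng_opts_even_iff:
  assumes "finite (carrier G)" "P \<subseteq> carrier G" "Q \<in> dng_opts G P"
  shows "even (card Q) \<longleftrightarrow> odd (card P)"
  using assms finite_subset[OF assms(2,1)] by (auto simp: dng_opts_iff)

section \<open>Available moves\<close>

context group
begin

lemma involution_settles:
  assumes fin: "finite (carrier G)" and M: "maximal_subgroup M G" "even (card M)" "Q \<subseteq> M"
    and t: "t \<in> Q" "t \<noteq> \<one>" "t \<otimes> t = \<one>"
  shows "\<not> only_odd_above G Q" "\<not> odd_extendable G Q"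
proof -
  show "\<not> only_odd_above G Q" using M by (auto simp: only_odd_above_def)
  show "\<not> odd_extendable G Q"
  proof
    assume "odd_extendable G Q"
    then obtain g where "insert g Q \<in> dng_positions G" and o: "only_odd_above G (insert g Q)"
      by (auto simp: odd_extendable_def)
    then obtain N where N: "maximal_subgroup N G" "insert g Q \<subseteq> N"
      using dng_positions_iff[OF fin] by blast
    then have "even (card N)"
      using subgroup_with_involution_even[OF fin maximal_subgroupD(1)] t by blast
    then show False using o N by (auto simp: only_odd_above_def)
  qed
qed

text \<open>Adding an involution of an even maximal subgroup above \<open>P\<close> settles the parity of the rest of
  the game. If \<open>P\<close> already contains the chosen involution, any other element of that maximal
  subgroup serves; one is left over because \<open>card P\<close> is odd in that case.\<close>

lemma settling_move:
  assumes fin: "finite (carrier G)" and "\<not> only_odd_above G P"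
    and or: "odd (card P) \<or> odd_extendable G P"
  obtains Q where "Q \<in> dng_opts G P" "\<not> only_odd_above G Q" "\<not> odd_extendable G Q"
proof -
  from assms(2) obtain M where M: "maximal_subgroup M G" "P \<subseteq> M" "even (card M)"
    by (auto simp: only_odd_above_def)
  note Ms = maximal_subgroupD[OF M(1)]
  obtain t where t: "t \<in> M" "t \<noteq> \<one>" "t \<otimes> t = \<one>"
    using even_order_involution[OF fin Ms(1) M(3)] .
  obtain g where g: "g \<in> M" "g \<notin> P" "t \<in> insert g P"
  proof (cases "t \<in> P")
    case True
    then have "\<not> odd_extendable G P" using involution_settles[OF fin M(1,3,2)] t by blast
    then have "P \<noteq> M" using or M(3) by auto
    then show ?thesis using that M(2) True by blast
  qed (use that t in blast)
  have "insert g P \<in> dng_opts G P"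
    unfolding dng_opts_iff dng_positions_iff[OF fin] using g M Ms by auto
  moreover have "insert g P \<subseteq> M" using g M by auto
  ultimately show ?thesis
    using that involution_settles[OF fin M(1,3)] g t by blast
qed

lemma odd_extending_move:
  assumes "\<not> only_odd_above G P" "odd_extendable G P"
  obtains Q where "Q \<in> dng_opts G P" "only_odd_above G Q"
proof -
  from assms(2) obtain g where g: "g \<in> carrier G" "insert g P \<in> dng_positions G"
      "only_odd_above G (insert g P)"
    by (auto simp: odd_extendable_def)
  then have "g \<notin> P" using assms(1) by (metis insert_absorb)
  then show ?thesis using that g by (auto simp: dng_opts_iff)
qed

text \<open>The element to add is taken from the intersection of all maximal subgroups above \<open>P\<close>, so
  that the same ones lie above the new position. One of them is odd, so the intersection has odd order and cannot be \<open>P\<close>.\<close>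

lemma neutral_move:
  assumes fin: "finite (carrier G)"
    and not_odd: "\<not> only_odd_above G P" and ext: "odd_extendable G P" and ev: "even (card P)"
  obtains Q where "Q \<in> dng_opts G P" "\<not> only_odd_above G Q" "odd_extendable G Q"
proof -
  let ?I = "\<Inter>{M. maximal_subgroup M G \<and> P \<subseteq> M}"
  from ext obtain h where h: "h \<in> carrier G" "insert h P \<in> dng_positions G"
      "only_odd_above G (insert h P)"
    by (auto simp: odd_extendable_def)
  then obtain N where N: "maximal_subgroup N G" "insert h P \<subseteq> N"
    using dng_positions_iff[OF fin] by blast
  then have oddN: "odd (card N)" using h by (auto simp: only_odd_above_def)
  have I: "subgroup ?I G"
    by (rule subgroups_Inter) (use N maximal_subgroupD in auto)
  have IN: "?I \<subseteq> N" using N by auto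
  have "?I \<noteq> P"
  proof
    assume "?I = P"
    \<comment> \<open>an involution of \<open>P\<close> would lie in the odd subgroup \<open>N\<close>\<close>
    then obtain t where "t \<in> P" "t \<noteq> \<one>" "t \<otimes> t = \<one>"
      using even_order_involution[OF fin I] ev by metis
    then show False
      using subgroup_with_involution_even[OF fin maximal_subgroupD(1)[OF N(1)]] N oddN by blast
  qed
  then obtain g where g: "g \<in> ?I" "g \<notin> P" by blast
  have same: "insert g P \<subseteq> M \<longleftrightarrow> P \<subseteq> M" if "maximal_subgroup M G" for M
    using g that by auto
  have "insert g P \<in> dng_opts G P"
    unfolding dng_opts_iff dng_positions_iff[OF fin]
    using g N IN maximal_subgroupD(2)[OF N(1)] by blast
  moreover have "\<not> only_odd_above G (insert g P)"
    using not_odd same by (auto simp: only_odd_above_def)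
  moreover have "odd_extendable G (insert g P)"
  proof -
    have "insert h (insert g P) \<subseteq> N" using N g IN by auto
    then have "insert h (insert g P) \<in> dng_positions G"
      unfolding dng_positions_iff[OF fin] using N(1) by (intro exI[of _ N]) simp
    moreover have "only_odd_above G (insert h (insert g P))"
      by (rule only_odd_above_mono[OF h(3)]) auto
    ultimately show ?thesis using h(1) by (auto simp: odd_extendable_def)
  qed
  ultimately show ?thesis using that by blast
qed

text \<open>An even \<open>P\<close> all of whose maximal overgroups are odd is not one of them, so it is not
  terminal.\<close>

lemma move_from_even:
  assumes fin: "finite (carrier G)"
    and P: "P \<in> dng_positions G" "only_odd_above G P" "even (card P)"
  obtains Q where "Q \<in> dng_opts G P"
proof -
  obtain M where M: "maximal_subgroup M G" "P \<subseteq> M"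
    using P dng_positions_iff[OF fin] by blast
  then have "P \<noteq> M" using P by (auto simp: only_odd_above_def)
  then obtain g where "g \<in> M" "g \<notin> P" using M by blast
  then have "insert g P \<in> dng_opts G P"
    unfolding dng_opts_iff dng_positions_iff[OF fin] using M maximal_subgroupD(2)[OF M(1)] by blast
  then show ?thesis by (rule that)
qed

section \<open>The nim-number of every position\<close>

lemma mex_dng_value_opts:
  assumes fin: "finite (carrier G)" and P: "P \<in> dng_positions G"
  shows "mex (dng_value G ` dng_opts G P) = dng_value G P"
proof -
  let ?V = "dng_value G ` dng_opts G P"
  have sub: "P \<subseteq> carrier G" using P by (simp add: dng_positions_def)
  note parity = dng_opts_even_iff[OF fin sub]
  have sup: "P \<subseteq> Q" if "Q \<in> dng_opts G P" for Q using that by (auto simp: dng_opts_iff)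
  show ?thesis
  proof (cases "only_odd_above G P")
    case True
    have val: "dng_value G Q = (if even (card P) then 0 else 1)" if "Q \<in> dng_opts G P" for Q
      using only_odd_above_mono[OF True sup[OF that]] parity[OF that] by (simp add: dng_value_def)
    show ?thesis
    proof (cases "even (card P)")
      case even: True
      obtain Q where "Q \<in> dng_opts G P" using move_from_even[OF fin P True even] .
      then have "?V = {0}" using val even by auto
      then show ?thesis using True even by (auto simp: dng_value_def intro!: mex_eqI)
    next
      case False
      then have "?V \<subseteq> {1}" using val by auto
      then show ?thesis using True False by (auto simp: dng_value_def intro!: mex_eqI)
    qed
  next
    case notodd: False
    show ?thesis
    proof (cases "odd_extendable G P")
      case True
      obtain Q1 where Q1: "Q1 \<in> dng_opts G P" "only_odd_above G Q1"
        using odd_extending_move[OF notodd True] .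
      obtain Q2 where Q2: "Q2 \<in> dng_opts G P" "\<not> only_odd_above G Q2" "\<not> odd_extendable G Q2"
        using settling_move[OF fin notodd] True by blast
      have small: "0 \<in> ?V" "1 \<in> ?V"
        using Q1 Q2 parity[OF Q1(1)] parity[OF Q2(1)]
        by (cases "even (card P)"; force simp: dng_value_def image_iff)+
      show ?thesis
      proof (cases "even (card P)")
        case even: True
        obtain Q3 where Q3: "Q3 \<in> dng_opts G P" "\<not> only_odd_above G Q3" "odd_extendable G Q3"
          using neutral_move[OF fin notodd True even] .
        then have "dng_value G Q3 = 2" using parity even by (simp add: dng_value_def)
        then have "2 \<in> ?V" using Q3(1) by (metis imageI)
        moreover have "3 \<notin> ?V" using dng_value_range(2)[of _ G] parity even by fastforce
        ultimately have "mex ?V = 3"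
          using small by (intro mex_eqI) (auto simp: less_Suc_eq numeral_3_eq_3 numeral_2_eq_2)
        then show ?thesis using notodd True even by (simp add: dng_value_def)
      next
        case False
        have "2 \<notin> ?V" using dng_value_range(1)[of _ G] parity False by fastforce
        then have "mex ?V = 2"
          using small by (intro mex_eqI) (auto simp: less_Suc_eq numeral_2_eq_2)
        then show ?thesis using notodd True False by (simp add: dng_value_def)
      qed
    next
      case notext: False
      have nonodd: "\<not> only_odd_above G Q" if "Q \<in> dng_opts G P" for Q
        using that notext by (auto simp: dng_opts_iff odd_extendable_def)
      show ?thesis
      proof (cases "even (card P)")
        case True
        have "0 \<notin> ?V" using nonodd parity True by (auto simp: dng_value_def)
        then show ?thesis using notodd notext True by (auto simp: dng_value_def intro!: mex_eqI)
      next
        case False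
        obtain Q where Q: "Q \<in> dng_opts G P" "\<not> only_odd_above G Q" "\<not> odd_extendable G Q"
          using settling_move[OF fin notodd] False by blast
        then have "dng_value G Q = 0" using parity False by (simp add: dng_value_def)
        then have "0 \<in> ?V" using Q(1) by (metis imageI)
        moreover have "1 \<notin> ?V" using nonodd parity False by (auto simp: dng_value_def)
        ultimately have "mex ?V = 1" by (intro mex_eqI) auto
        then show ?thesis using notodd notext False by (simp add: dng_value_def)
      qed
    qed
  qed
qed

lemma nim_number_eq_dng_value:
  assumes fin: "finite (carrier G)" and "P \<in> dng_positions G"
  shows "nim_number (dng_opts G) P = dng_value G P"
  using assms(2)
proof (induction P rule: wf_induct_rule[OF wf_dng_opts[OF fin]])
  case (1 P)
  have "nim_number (dng_opts G) Q = dng_value G Q" if "Q \<in> dng_opts G P" for Q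
    using 1(1)[of Q] that by (auto simp: dng_opts_iff)
  then have "{nim_number (dng_opts G) Q | Q. Q \<in> dng_opts G P} = dng_value G ` dng_opts G P"
    by force
  then show ?case
    using nim_number_rec[OF wf_dng_opts[OF fin], of P] mex_dng_value_opts[OF fin 1(2)] by simp
qed

section \<open>The starting position\<close>

text \<open>Elements of an odd subgroup are squares of their own powers, so when \<open>g\<close> generates \<open>G\<close> they
  all lie in the subgroup generated by \<open>g \<otimes> g\<close>. A maximal subgroup containing \<open>g \<otimes> g\<close> thus
  contains the odd maximal subgroup \<open>M\<close>, and so equals it.\<close>

lemma odd_above_generator_square:
  assumes fin: "finite (carrier G)" and g: "g \<in> carrier G" "generate G {g} = carrier G"
    and M: "maximal_subgroup M G" "odd (card M)"
    and N: "maximal_subgroup N G" "g \<otimes> g \<in> N"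
  shows "odd (card N)"
proof -
  note Ms = maximal_subgroupD[OF M(1)] and Ns = maximal_subgroupD[OF N(1)]
  have "M \<subseteq> N"
  proof
    fix m assume m: "m \<in> M"
    then have mG: "m \<in> carrier G" using Ms by auto
    obtain k where k: "card M = 2 * k + 1" using M(2) by (elim oddE)
    let ?r = "m [^] Suc k"
    have "?r \<in> generate G {g}" using mG g by simp
    then obtain j :: int where j: "?r = g [^] j" using generate_pow[OF g(1)] by blast
    have "m = m [^] (Suc (card M))"
      using pow_subgroup_card_eq_one[OF fin Ms(1) m] mG by simp
    also have "\<dots> = ?r \<otimes> ?r" using k nat_pow_mult[OF mG, of "Suc k" "Suc k"] by (simp add: mult_2)
    also have "\<dots> = (g \<otimes> g) [^] j"
      unfolding j using g(1) by (simp add: int_pow_mult_distrib)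
    finally show "m \<in> N" using subgroup_int_pow_closed[OF Ns(1) N(2)] by metis
  qed
  then show ?thesis using maximal_subgroup_subset_eq[OF M(1) N(1)] M(2) by simp
qed

text \<open>If \<open>g \<otimes> g\<close> generated \<open>G\<close>, squaring would be a surjective and hence injective map on
  \<open>G\<close>, but an involution has the same square as \<open>\<one>\<close>.\<close>

lemma square_not_generator:
  assumes fin: "finite (carrier G)" and "even (card (carrier G))" and g: "g \<in> carrier G"
  shows "generate G {g \<otimes> g} \<noteq> carrier G"
proof
  assume gen: "generate G {g \<otimes> g} = carrier G"
  have "carrier G \<subseteq> (\<lambda>x. x \<otimes> x) ` carrier G"
  proof
    fix x assume "x \<in> carrier G"
    then obtain k :: int where "x = (g \<otimes> g) [^] k"
      using gen generate_pow[of "g \<otimes> g"] g by blast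
    then have "x = g [^] k \<otimes> g [^] k" using g by (simp add: int_pow_mult_distrib)
    then show "x \<in> (\<lambda>x. x \<otimes> x) ` carrier G" using g by blast
  qed
  then have "inj_on (\<lambda>x. x \<otimes> x) (carrier G)"
    using fin finite_surj_inj[OF fin] by blast
  moreover obtain t where "t \<in> carrier G" "t \<noteq> \<one>" "t \<otimes> t = \<one>"
    using even_order_involution[OF fin subgroup_self assms(2)] .
  ultimately show False by (auto dest: inj_onD[of _ _ t \<one>])
qed

lemma odd_extendable_empty_iff:
  assumes fin: "finite (carrier G)"
    and M: "maximal_subgroup M G" "odd (card M)" and E: "maximal_subgroup E G" "even (card E)"
  shows "odd_extendable G {} \<longleftrightarrow> \<not> covers {M. maximal_subgroup M G \<and> even (card M)} G"
    (is "_ \<longleftrightarrow> \<not> covers ?\<E> G")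
proof
  assume "odd_extendable G {}"
  then show "\<not> covers ?\<E> G"
    by (fastforce simp: odd_extendable_def only_odd_above_def covers_def)
next
  assume "\<not> covers ?\<E> G"
  moreover have "\<Union>?\<E> \<subseteq> carrier G" using maximal_subgroupD(2) by auto
  ultimately obtain g where g: "g \<in> carrier G" "g \<notin> \<Union>?\<E>" by (auto simp: covers_def)
  show "odd_extendable G {}"
  proof (cases "generate G {g} = carrier G")
    case False
    then show ?thesis
      using g by (force simp: odd_extendable_def only_odd_above_def dng_positions_def)
  next
    case True
    have "card E dvd order G"
      using lagrange[OF maximal_subgroupD(1)[OF E(1)]] by (metis dvd_triv_right)
    then have "even (card (carrier G))" using E(2) by (auto simp: order_def)
    then have "{g \<otimes> g} \<in> dng_positions G"
      using square_not_generator[OF fin] g(1) by (simp add: dng_positions_def)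
    moreover have "only_odd_above G {g \<otimes> g}"
      using odd_above_generator_square[OF fin g(1) True M] by (simp add: only_odd_above_def)
    ultimately show ?thesis using g(1) by (auto simp: odd_extendable_def)
  qed
qed

end

theorem corollary6p4:
  fixes G :: "('a, 'b) monoid_scheme"
  assumes "group G"
    and "finite (carrier G)"
    and "carrier G \<noteq> {\<one>\<^bsub>G\<^esub>}"
  shows "((\<forall>M. maximal_subgroup M G \<longrightarrow> odd (card M)) \<longrightarrow> DNG G = 1) \<and>
    ((\<forall>M. maximal_subgroup M G \<longrightarrow> even (card M)) \<longrightarrow> DNG G = 0) \<and>
    ((\<exists>M. maximal_subgroup M G \<and> even (card M)) \<and>
     (\<exists>M. maximal_subgroup M G \<and> odd (card M)) \<longrightarrow>
       (covers {M. maximal_subgroup M G \<and> even (card M)} G \<longrightarrow> DNG G = 0) \<and>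
       (\<not> covers {M. maximal_subgroup M G \<and> even (card M)} G \<longrightarrow> DNG G = 3))"
proof -
  interpret group G by fact
  note fin = assms(2)
  have pos: "{} \<in> dng_positions G" using empty_dng_position[OF assms(3)] .
  have DNG: "DNG G = dng_value G {}"
    unfolding DNG_def using nim_number_eq_dng_value[OF fin pos] .
  have odd_iff: "only_odd_above G {} \<longleftrightarrow> (\<forall>M. maximal_subgroup M G \<longrightarrow> odd (card M))"
    by (simp add: only_odd_above_def)
  have "DNG G = 0" if ev: "\<forall>M. maximal_subgroup M G \<longrightarrow> even (card M)"
  proof -
    have "\<not> only_odd_above G P" if "P \<in> dng_positions G" for P
      using that ev dng_positions_iff[OF fin] by (auto simp: only_odd_above_def)
    then show ?thesis using pos by (auto simp: DNG dng_value_def odd_extendable_def)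
  qed
  moreover have "DNG G = (if covers {M. maximal_subgroup M G \<and> even (card M)} G then 0 else 3)"
    if "\<exists>M. maximal_subgroup M G \<and> even (card M)" "\<exists>M. maximal_subgroup M G \<and> odd (card M)"
  proof -
    have "\<not> only_odd_above G {}" using that(1) odd_iff by auto
    moreover have "odd_extendable G {} \<longleftrightarrow>
        \<not> covers {M. maximal_subgroup M G \<and> even (card M)} G"
      using that odd_extendable_empty_iff[OF fin] by blast
    ultimately show ?thesis by (simp add: DNG dng_value_def)
  qed
  ultimately show ?thesis using odd_iff by (auto simp: DNG dng_value_def)
qed

end
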